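(* Let $\mu\in\mathcal{P}_2$ be such that $M_2(\mu)=1$, and let $n$ be the number of nonzero eigenvalues of $S_\mu$, counted with multiplicity. Then $\operatorname{PFP}(\mu)\ge\frac{1}{n}$. Moreover, equality holds if and only if $\mu$ is a probabilistic tight frame for $E_\mu$.
   Context: $\mathbb{R}^N$ carries the standard Euclidean inner product $\langle\cdot,\cdot\rangle$ and norm $\|\cdot\|$. For a Borel probability measure $\mu$ on $\mathbb{R}^N$, $M_2^2(\mu):=\int_{\mathbb{R}^N}\|x\|^2\,d\mu(x)$ (that is, $M_2(\mu)$ is the nonnegative square root of this quantity), and $\mathcal{P}_2$ is the set of all Borel probability measures on $\mathbb{R}^N$ with $M_2^2(\mu)<\infty$. For $\mu\in\mathcal{P}_2$ the probabilistic frame potential is $\operatorname{PFP}(\mu)=\iint_{\mathbb{R}^N\times\mathbb{R}^N}|\langle x,y\rangle|^2\,d\mu(x)\,d\mu(y)$, and the probabilistic frame operator is the linear map $S_\mu:\mathbb{R}^N\to\mathbb{R}^N$, $S_\mu(x)=\int_{\mathbb{R}^N}y\,\langle x,y\rangle\,d\mu(y)$. The support is $\operatorname{supp}(\mu)=\{x\in\mathbb{R}^N:\mu(U)>0\text{ for every open }U\ni x\}$, and $E_\mu$ is the linear span of $\operatorname{supp}(\mu)$. That $\mu$ is a probabilistic tight frame for $E_\mu$ means (identifying $E_\mu$ with the Euclidean space of dimension $\dim E_\mu$) that there is a constant $0<A<\infty$ such that $\int_{E_\mu}|\langle x,y\rangle|^2\,d\mu(y)=A\|x\|^2$ for all $x\in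 E_\mu$. *)

theory Defs
  imports "HOL-Probability.Probability"
begin

definition P2 :: "'a::euclidean_space measure set" where
  "P2 = {\<mu>. prob_space \<mu> \<and> sets \<mu> = sets borel \<and>
            (\<integral>\<^sup>+ x. ennreal ((norm x)\<^sup>2) \<partial>\<mu>) < \<infinity>}"

text \<open>On \<^const>\<open>P2\<close> all integrands below are integrable, so the Bochner integrals agree
  with the intended ones; outside \<^const>\<open>P2\<close> they may be junk values.\<close>

definition M2 :: "'a::euclidean_space measure \<Rightarrow> real" where
  "M2 \<mu> = sqrt (LINT x|\<mu>. (norm x)\<^sup>2)"

definition PFP :: "'a::euclidean_space measure \<Rightarrow> real" where
  "PFP \<mu> = (LINT y|\<mu>. (LINT x|\<mu>. \<bar>x \<bullet> y\<bar>\<^sup>2))"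

definition frame_operator :: "'a::euclidean_space measure \<Rightarrow> 'a \<Rightarrow> 'a" where
  "frame_operator \<mu> x = (LINT y|\<mu>. (x \<bullet> y) *\<^sub>R y)"

definition eigenspace :: "('a::euclidean_space \<Rightarrow> 'a) \<Rightarrow> real \<Rightarrow> 'a set" where
  "eigenspace f c = {x. f x = c *\<^sub>R x}"

definition eigenvalues :: "('a::euclidean_space \<Rightarrow> 'a) \<Rightarrow> real set" where
  "eigenvalues f = {c. \<exists>x. x \<noteq> 0 \<and> f x = c *\<^sub>R x}"

text \<open>The multiplicity of an eigenvalue is the dimension of its eigenspace. For a self-adjoint
  operator, such as the frame operator of a measure in \<^const>\<open>P2\<close>, all complex eigenvalues are
  real and this coincides with the algebraic multiplicity. The index set of the sum is finite
  whenever \<open>f\<close> is linear.\<close>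

definition num_nonzero_eigenvalues :: "('a::euclidean_space \<Rightarrow> 'a) \<Rightarrow> nat" where
  "num_nonzero_eigenvalues f = (\<Sum>c\<in>eigenvalues f - {0}. dim (eigenspace f c))"

definition msupport :: "'a::euclidean_space measure \<Rightarrow> 'a set" where
  "msupport \<mu> = {x. \<forall>U. open U \<and> x \<in> U \<longrightarrow> emeasure \<mu> U > 0}"

definition support_span :: "'a::euclidean_space measure \<Rightarrow> 'a set" where
  "support_span \<mu> = span (msupport \<mu>)"

definition prob_tight_frame_for :: "'a::euclidean_space measure \<Rightarrow> 'a set \<Rightarrow> bool" where
  "prob_tight_frame_for \<mu> E \<longleftrightarrow>
     (\<exists>A>0. \<forall>x\<in>E. (LINT y:E|\<mu>. \<bar>x \<bullet> y\<bar>\<^sup>2) = A * (norm x)\<^sup>2)"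

end

theory Submission
  imports Defs
begin

text \<open>
  The frame operator \<open>S\<close> of \<open>\<mu>\<close> is self-adjoint, since \<open>S x \<bullet> z\<close> is the integral of
  \<open>(x \<bullet> y) * (z \<bullet> y)\<close> over \<open>y\<close>. Hence there is an orthonormal basis of eigenvectors \<open>b\<close>, with
  eigenvalues \<open>q\<^sub>b = S b \<bullet> b\<close>. Everything in the statement can be read off from these numbers:

  \<^item> their sum is the trace of \<open>S\<close>, and expanding \<open>(norm y)\<^sup>2\<close> in the basis shows that the trace is
    the second moment, here \<open>1\<close> (\<open>frame_operator_trace\<close>);
  \<^item> the sum of their squares is the potential, because the inner integral of the potential is
    \<open>S y \<bullet> y\<close>, the sum of the \<open>q\<^sub>b * (b \<bullet> y)\<^sup>2\<close>, and integrating \<open>(b \<bullet> y)\<^sup>2\<close> gives \<open>q\<^sub>b\<close> again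
    (\<open>PFP_eq_sum_squares\<close>);
  \<^item> \<open>n\<close> is the number of \<open>b\<close> with \<open>q\<^sub>b \<noteq> 0\<close> (\<open>num_nonzero_eigenvalues_eq_card\<close>).

  So \<open>n\<close> numbers with sum \<open>1\<close> are given, and their sum of squares exceeds \<open>1 / n\<close> by the sum of
  the squared deviations from their mean \<open>1 / n\<close>. This is the inequality, and equality holds exactly
  when all nonzero eigenvalues coincide.

  It remains to see that the latter means tightness on \<open>E\<close>, the span of the support. Almost every
  point lies in \<open>E\<close>, so the integral in the definition of a tight frame is \<open>S x \<bullet> x\<close>, and tightness
  says that this quadratic form is a multiple of \<open>(norm x)\<^sup>2\<close> on \<open>E\<close>. The translation into
  eigenvalues works because \<open>E\<close> is the span of precisely those \<open>b\<close> with \<open>q\<^sub>b \<noteq> 0\<close>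
  (\<open>support_span_eq_span_nonzero_eigenvectors\<close>).
\<close>

section \<open>Spectral theorem for self-adjoint operators\<close>

lemma quadratic_nonneg_imp_linear_coeff_zero:
  fixes a b :: real
  assumes "\<And>t. 0 \<le> 2 * t * a + t\<^sup>2 * b"
  shows "a = 0"
proof (rule ccontr)
  assume "a \<noteq> 0"
  define d where "d = \<bar>b\<bar> + 1"
  have d: "d > 0" "b < d" by (auto simp: d_def)
  \<comment> \<open>Near the origin the linear term dominates; at \<open>t = - a / d\<close> the sum is negative.\<close>
  have "2 * (- a / d) * a + (- a / d)\<^sup>2 * b = (a\<^sup>2 / d\<^sup>2) * (b - 2 * d)"
    using d by (simp add: field_simps power2_eq_square)
  moreover have "\<dots> < 0"
    using \<open>a \<noteq> 0\<close> d by (intro mult_pos_neg) auto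
  ultimately show False using assms[of "- a / d"] by linarith
qed

text \<open>
  A maximiser \<open>u\<close> of the quadratic form on the unit sphere of \<open>V\<close> is an eigenvector for the maximal
  value \<open>c\<close>: the form of \<open>g = c - f\<close> is nonnegative on \<open>V\<close> and vanishes at \<open>u\<close>, so its first
  variation at \<open>u\<close> vanishes in every direction of \<open>V\<close>, in particular in the direction \<open>g u\<close>.
\<close>

lemma selfadjoint_eigenvector_in_invariant_subspace:
  fixes f :: "'a::euclidean_space \<Rightarrow> 'a"
  assumes lin: "linear f" and adj: "\<And>x y. f x \<bullet> y = x \<bullet> f y"
    and V: "subspace V" and inv: "f ` V \<subseteq> V" and nz: "V \<noteq> {0}"
  obtains u c where "u \<in> V" "norm u = 1" "f u = c *\<^sub>R u"
proof -
  obtain w where w: "w \<in> V" "w \<noteq> 0" using nz subspace_0[OF V] by blast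
  have "w /\<^sub>R norm w \<in> V \<inter> sphere 0 1"
    using w V by (simp add: subspace_scale)
  hence ne: "V \<inter> sphere 0 1 \<noteq> {}" by blast
  have cpt: "compact (V \<inter> sphere 0 1)"
    by (intro closed_Int_compact closed_subspace V compact_sphere)
  have "continuous_on (V \<inter> sphere 0 1) (\<lambda>x. f x \<bullet> x)"
    using lin by (intro continuous_intros linear_continuous_on) (simp add: linear_conv_bounded_linear)
  then obtain u where u: "u \<in> V" "norm u = 1"
    and max: "\<And>y. y \<in> V \<Longrightarrow> norm y = 1 \<Longrightarrow> f y \<bullet> y \<le> f u \<bullet> u"
    using continuous_attains_sup[OF cpt ne, of "\<lambda>x. f x \<bullet> x"] by auto
  define c where "c = f u \<bullet> u"
  define g where "g = (\<lambda>x. c *\<^sub>R x - f x)"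
  have glin: "linear g"
    unfolding g_def using lin by (intro linear_compose_sub linear_scale_self)
  have gadj: "g x \<bullet> y = x \<bullet> g y" for x y
    by (simp add: g_def inner_diff adj)
  have gV: "g x \<in> V" if "x \<in> V" for x
    using that inv V by (auto simp: g_def intro!: subspace_diff subspace_scale)
  have gpos: "0 \<le> g x \<bullet> x" if x: "x \<in> V" for x
  proof (cases "x = 0")
    case False
    have "f (x /\<^sub>R norm x) \<bullet> (x /\<^sub>R norm x) \<le> c"
      unfolding c_def using x False V by (intro max) (simp_all add: subspace_scale)
    hence "f x \<bullet> x \<le> c * (norm x)\<^sup>2"
      using False by (simp add: linear_scale[OF lin] field_simps power2_eq_square)
    thus ?thesis by (simp add: g_def inner_diff dot_square_norm)
  qed simp
  have gu: "g u \<bullet> u = 0"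
    using u by (simp add: g_def inner_diff c_def dot_square_norm)
  have "g u \<bullet> w = 0" if w: "w \<in> V" for w
  proof (rule quadratic_nonneg_imp_linear_coeff_zero)
    fix t :: real
    have "0 \<le> g (u + t *\<^sub>R w) \<bullet> (u + t *\<^sub>R w)"
      using u w V by (intro gpos) (simp add: subspace_add subspace_scale)
    also have "\<dots> = 2 * t * (g u \<bullet> w) + t\<^sup>2 * (g w \<bullet> w)"
      using gu gadj[of w u]
      by (simp add: linear_add[OF glin] linear_scale[OF glin] inner_add inner_commute
          power2_eq_square algebra_simps)
    finally show "0 \<le> 2 * t * (g u \<bullet> w) + t\<^sup>2 * (g w \<bullet> w)" .
  qed
  from this[OF gV[OF u(1)]] have "f u = c *\<^sub>R u" by (simp add: g_def)
  with u that show ?thesis by blast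
qed

text \<open>
  The eigenvalue of a unit eigenvector \<open>b\<close> is \<open>f b \<bullet> b\<close>. Writing it in this way avoids a separate
  function that assigns eigenvalues to basis vectors.
\<close>

definition orthonormal_eigenbasis :: "('a::euclidean_space \<Rightarrow> 'a) \<Rightarrow> 'a set \<Rightarrow> 'a set \<Rightarrow> bool" where
  "orthonormal_eigenbasis f V B \<longleftrightarrow> finite B \<and> pairwise orthogonal B \<and> span B = V \<and>
     (\<forall>b\<in>B. norm b = 1 \<and> f b = (f b \<bullet> b) *\<^sub>R b)"

text \<open>
  Split off one eigenvector \<open>u\<close>; self-adjointness makes its orthogonal complement in \<open>V\<close> invariant
  again, and the dimension has dropped.
\<close>

lemma selfadjoint_has_orthonormal_eigenbasis:
  fixes f :: "'a::euclidean_space \<Rightarrow> 'a"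
  assumes lin: "linear f" and adj: "\<And>x y. f x \<bullet> y = x \<bullet> f y"
    and "subspace V" and "f ` V \<subseteq> V"
  shows "\<exists>B. orthonormal_eigenbasis f V B"
  using assms(3,4)
proof (induction "dim V" arbitrary: V rule: less_induct)
  case less
  show ?case
  proof (cases "V = {0}")
    case True
    hence "orthonormal_eigenbasis f V {}" by (simp add: orthonormal_eigenbasis_def)
    thus ?thesis by blast
  next
    case False
    then obtain u c where u: "u \<in> V" "norm u = 1" and fu: "f u = c *\<^sub>R u"
      using selfadjoint_eigenvector_in_invariant_subspace[OF lin adj less.prems] by blast
    have uu: "u \<bullet> u = 1" using u by (simp add: dot_square_norm)
    define W where "W = V \<inter> {x. x \<bullet> u = 0}"
    have W: "subspace W"
      unfolding W_def using less.prems(1)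
      by (auto simp: subspace_def inner_add_left)
    have "u \<notin> W" using uu by (simp add: W_def)
    moreover have "W \<subseteq> V" by (simp add: W_def)
    ultimately have "W \<subset> V" using u by blast
    hence dim: "dim W < dim V"
      using W less.prems(1) by (intro dim_psubset) (simp add: span_eq_iff[THEN iffD2])
    have "f ` W \<subseteq> W"
      using less.prems(2) by (auto simp: W_def adj fu)
    from less.hyps[OF dim W this] obtain B where B: "orthonormal_eigenbasis f W B" by blast
    hence BW: "span B = W" unfolding orthonormal_eigenbasis_def by blast
    have perp: "b \<bullet> u = 0" if "b \<in> B" for b
      using that BW span_base[of b B] by (auto simp: W_def)
    have "span (insert u B) = V"
    proof
      have "insert u B \<subseteq> V" using u BW span_superset[of B] by (auto simp: W_def)
      thus "span (insert u B) \<subseteq> V" using less.prems(1) by (rule span_minimal)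
      show "V \<subseteq> span (insert u B)"
      proof
        fix v assume "v \<in> V"
        hence "v - (v \<bullet> u) *\<^sub>R u \<in> W"
          using u uu less.prems(1)
          by (auto simp: W_def inner_diff intro!: subspace_diff subspace_scale)
        thus "v \<in> span (insert u B)" using BW span_breakdown_eq[of v u B] by blast
      qed
    qed
    moreover have "pairwise orthogonal (insert u B)"
    proof -
      have "pairwise orthogonal B" using B unfolding orthonormal_eigenbasis_def by blast
      thus ?thesis using perp by (simp add: pairwise_insert orthogonal_def inner_commute[of u])
    qed
    moreover have "norm b = 1 \<and> f b = (f b \<bullet> b) *\<^sub>R b" if b: "b \<in> insert u B" for b
    proof (cases "b = u")
      case True
      have "f u = (f u \<bullet> u) *\<^sub>R u" by (simp add: fu uu)
      with u(2) show ?thesis unfolding True by (rule conjI)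
    next
      case False
      with b have "b \<in> B" by simp
      thus ?thesis using B unfolding orthonormal_eigenbasis_def by (elim conjE) (rule bspec)
    qed
    moreover have "finite (insert u B)"
      using B unfolding orthonormal_eigenbasis_def by simp
    ultimately have "orthonormal_eigenbasis f V (insert u B)"
      unfolding orthonormal_eigenbasis_def by (iprover intro: ballI)
    thus ?thesis by blast
  qed
qed

section \<open>Coordinates in an orthonormal eigenbasis\<close>

context
  fixes f :: "'a::euclidean_space \<Rightarrow> 'a" and B :: "'a set"
  assumes adj: "\<And>x y. f x \<bullet> y = x \<bullet> f y"
    and B: "orthonormal_eigenbasis f UNIV B"
begin

lemma eigenbasis_finite: "finite B"
  and eigenbasis_orthogonal: "pairwise orthogonal B"
  and eigenbasis_norm: "b \<in> B \<Longrightarrow> norm b = 1"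
  and eigenbasis_span: "span B = UNIV"
  and eigenbasis_eigen: "b \<in> B \<Longrightarrow> f b = (f b \<bullet> b) *\<^sub>R b"
  using B unfolding orthonormal_eigenbasis_def by blast+

lemma eigenbasis_expand: "(\<Sum>b\<in>B. (x \<bullet> b) *\<^sub>R b) = x"
  by (rule orthonormal_basis_expand)
     (use eigenbasis_finite eigenbasis_orthogonal eigenbasis_norm eigenbasis_span in auto)

lemma eigenbasis_parseval: "x \<bullet> y = (\<Sum>b\<in>B. (x \<bullet> b) * (y \<bullet> b))"
proof -
  have "x \<bullet> y = (\<Sum>b\<in>B. (x \<bullet> b) *\<^sub>R b) \<bullet> y" by (simp only: eigenbasis_expand)
  also have "\<dots> = (\<Sum>b\<in>B. (x \<bullet> b) * (y \<bullet> b))"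
    by (simp only: inner_sum_left inner_scaleR_left inner_commute[of y])
  finally show ?thesis .
qed

lemma eigenbasis_coordinate: "b \<in> B \<Longrightarrow> f x \<bullet> b = (f b \<bullet> b) * (x \<bullet> b)"
proof -
  assume b: "b \<in> B"
  have "f x \<bullet> b = x \<bullet> ((f b \<bullet> b) *\<^sub>R b)"
    unfolding adj[of x] by (simp only: eigenbasis_eigen[OF b, symmetric])
  thus ?thesis by simp
qed

lemma eigenbasis_quadratic_form: "f x \<bullet> x = (\<Sum>b\<in>B. (f b \<bullet> b) * (x \<bullet> b)\<^sup>2)"
proof -
  have "f x \<bullet> x = (\<Sum>b\<in>B. (f x \<bullet> b) * (x \<bullet> b))" by (rule eigenbasis_parseval)
  also have "\<dots> = (\<Sum>b\<in>B. (f b \<bullet> b) * (x \<bullet> b)\<^sup>2)"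
    by (intro sum.cong refl, subst eigenbasis_coordinate) (simp_all add: power2_eq_square)
  finally show ?thesis .
qed

lemma mem_span_subset_eigenbasis:
  assumes "C \<subseteq> B"
  shows "x \<in> span C \<longleftrightarrow> (\<forall>b\<in>B - C. x \<bullet> b = 0)"
proof
  assume x: "x \<in> span C"
  show "\<forall>b\<in>B - C. x \<bullet> b = 0"
  proof
    fix b assume b: "b \<in> B - C"
    have "orthogonal b c" if "c \<in> C" for c
      using that b assms by (intro pairwiseD[OF eigenbasis_orthogonal]) auto
    with x have "orthogonal b x" by (rule orthogonal_to_span)
    thus "x \<bullet> b = 0" by (simp add: orthogonal_def inner_commute)
  qed
next
  assume *: "\<forall>b\<in>B - C. x \<bullet> b = 0"
  have "x = (\<Sum>b\<in>B. (x \<bullet> b) *\<^sub>R b)" by (simp add: eigenbasis_expand)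
  also have "\<dots> = (\<Sum>b\<in>C. (x \<bullet> b) *\<^sub>R b)"
    using * assms eigenbasis_finite by (intro sum.mono_neutral_right) auto
  also have "\<dots> \<in> span C" by (intro span_sum span_scale span_base)
  finally show "x \<in> span C" .
qed

text \<open>
  The equation \<open>f x = c *\<^sub>R x\<close> decouples in the basis: each coordinate \<open>x \<bullet> b\<close> has to vanish unless
  \<open>f b \<bullet> b = c\<close>.
\<close>

lemma eigenspace_eq_span: "eigenspace f c = span {b \<in> B. f b \<bullet> b = c}"
proof -
  have "x \<in> eigenspace f c \<longleftrightarrow> x \<in> span {b \<in> B. f b \<bullet> b = c}" for x
  proof -
    have "x \<in> eigenspace f c \<longleftrightarrow> (\<forall>b\<in>B. f x \<bullet> b = c * (x \<bullet> b))"
    proof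
      assume *: "\<forall>b\<in>B. f x \<bullet> b = c * (x \<bullet> b)"
      have "f x = (\<Sum>b\<in>B. (f x \<bullet> b) *\<^sub>R b)" by (rule eigenbasis_expand[symmetric])
      also have "\<dots> = c *\<^sub>R (\<Sum>b\<in>B. (x \<bullet> b) *\<^sub>R b)" using * by (simp add: scaleR_sum_right)
      also have "\<dots> = c *\<^sub>R x" by (simp only: eigenbasis_expand)
      finally show "x \<in> eigenspace f c" by (simp add: eigenspace_def)
    qed (simp add: eigenspace_def)
    also have "\<dots> \<longleftrightarrow> (\<forall>b\<in>B - {b \<in> B. f b \<bullet> b = c}. x \<bullet> b = 0)"
      by (auto simp: eigenbasis_coordinate[of _ x])
    also have "\<dots> \<longleftrightarrow> x \<in> span {b \<in> B. f b \<bullet> b = c}"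
      by (intro mem_span_subset_eigenbasis[symmetric]) auto
    finally show ?thesis .
  qed
  thus ?thesis by blast
qed

lemma eigenbasis_subset_dim:
  assumes "C \<subseteq> B" shows "dim (span C) = card C"
proof -
  have "pairwise orthogonal C" "0 \<notin> C"
    using assms eigenbasis_orthogonal eigenbasis_norm[of 0] by (auto intro: pairwise_subset)
  hence "independent C" by (rule pairwise_orthogonal_independent)
  thus ?thesis by (rule dim_span_eq_card_independent)
qed

lemma eigenvalues_eq_image: "eigenvalues f = (\<lambda>b. f b \<bullet> b) ` B"
proof
  show "(\<lambda>b. f b \<bullet> b) ` B \<subseteq> eigenvalues f"
  proof (rule image_subsetI)
    fix b assume b: "b \<in> B"
    hence "b \<noteq> 0" using eigenbasis_norm by force
    with eigenbasis_eigen[OF b] show "f b \<bullet> b \<in> eigenvalues f"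
      unfolding eigenvalues_def by blast
  qed
  show "eigenvalues f \<subseteq> (\<lambda>b. f b \<bullet> b) ` B"
  proof
    fix c assume "c \<in> eigenvalues f"
    then obtain x where "x \<noteq> 0" "x \<in> eigenspace f c"
      by (auto simp: eigenvalues_def eigenspace_def)
    hence "{b \<in> B. f b \<bullet> b = c} \<noteq> {}"
      by (auto simp: eigenspace_eq_span simp del: Collect_empty_eq)
    thus "c \<in> (\<lambda>b. f b \<bullet> b) ` B" by auto
  qed
qed

text \<open>
  Grouping the basis vectors by their eigenvalue, each group is a basis of its eigenspace.
\<close>

lemma num_nonzero_eigenvalues_eq_card:
  "num_nonzero_eigenvalues f = card {b \<in> B. f b \<bullet> b \<noteq> 0}"
proof -
  let ?P = "{b \<in> B. f b \<bullet> b \<noteq> 0}" and ?q = "\<lambda>b. f b \<bullet> b"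
  have "num_nonzero_eigenvalues f = (\<Sum>c\<in>eigenvalues f - {0}. card {b \<in> B. ?q b = c})"
    unfolding num_nonzero_eigenvalues_def eigenspace_eq_span
    by (intro sum.cong refl eigenbasis_subset_dim) auto
  also have "\<dots> = (\<Sum>c\<in>?q ` ?P. card {b \<in> ?P. ?q b = c})"
    by (intro sum.cong arg_cong[where f = card]) (auto simp: eigenvalues_eq_image)
  also have "\<dots> = card ?P"
    using eigenbasis_finite sum.image_gen[of ?P "\<lambda>_. 1::nat" ?q] by simp
  finally show ?thesis .
qed

end

section \<open>The frame operator of a measure with finite second moment\<close>

context
  fixes \<mu> :: "'a::euclidean_space measure"
  assumes \<mu>: "\<mu> \<in> P2"
begin

lemma P2_sets [measurable_cong]: "sets \<mu> = sets borel"
  using \<mu> by (auto simp: P2_def)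

lemma P2_space [simp]: "space \<mu> = UNIV"
  using sets_eq_imp_space_eq[OF P2_sets] by simp

lemma P2_integrable_norm_square: "integrable \<mu> (\<lambda>x. (norm x)\<^sup>2)"
  by (rule integrableI_nonneg) (use \<mu> in \<open>auto simp: P2_def\<close>)

lemma P2_integrable_frame: "integrable \<mu> (\<lambda>y. (x \<bullet> y) *\<^sub>R y)"
proof (rule Bochner_Integration.integrable_bound)
  show "integrable \<mu> (\<lambda>y. norm x * (norm y)\<^sup>2)"
    using P2_integrable_norm_square by simp
  show "AE y in \<mu>. norm ((x \<bullet> y) *\<^sub>R y) \<le> norm (norm x * (norm y)\<^sup>2)"
  proof (rule AE_I2)
    fix y show "norm ((x \<bullet> y) *\<^sub>R y) \<le> norm (norm x * (norm y)\<^sup>2)"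
      using mult_right_mono[OF Cauchy_Schwarz_ineq2[of x y] norm_ge_zero[of y]]
      by (simp add: power2_eq_square mult.assoc)
  qed
qed measurable

lemma P2_integrable_inner_inner: "integrable \<mu> (\<lambda>y. (x \<bullet> y) * (z \<bullet> y))"
  using integrable_inner_left[OF P2_integrable_frame[of x], of z] by (simp add: inner_commute)

lemma frame_operator_inner: "frame_operator \<mu> x \<bullet> z = (LINT y|\<mu>. (x \<bullet> y) * (z \<bullet> y))"
  using integral_inner_left[OF P2_integrable_frame[of x], of z]
  by (simp add: frame_operator_def inner_commute)

lemma frame_operator_quadratic_form: "frame_operator \<mu> x \<bullet> x = (LINT y|\<mu>. (x \<bullet> y)\<^sup>2)"
  by (simp add: frame_operator_inner power2_eq_square)

lemma frame_operator_selfadjoint: "frame_operator \<mu> x \<bullet> z = x \<bullet> frame_operator \<mu> z"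
proof -
  have "frame_operator \<mu> x \<bullet> z = frame_operator \<mu> z \<bullet> x"
    by (simp only: frame_operator_inner mult.commute)
  thus ?thesis by (simp only: inner_commute)
qed

lemma frame_operator_linear: "linear (frame_operator \<mu>)"
  by (rule linearI)
     (simp_all add: frame_operator_def inner_add_left scaleR_add_left P2_integrable_frame
       flip: scaleR_scaleR)

lemma frame_operator_has_orthonormal_eigenbasis:
  "\<exists>B. orthonormal_eigenbasis (frame_operator \<mu>) UNIV B"
  by (rule selfadjoint_has_orthonormal_eigenbasis)
     (auto simp: frame_operator_selfadjoint frame_operator_linear)

section \<open>The support\<close>

lemma msupport_subset_closed:
  assumes "closed C" "AE x in \<mu>. x \<in> C"
  shows "msupport \<mu> \<subseteq> C"
proof
  fix x assume x: "x \<in> msupport \<mu>"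
  have "emeasure \<mu> (- C) = 0"
    using assms by (subst (asm) AE_iff_measurable[of "- C"]) (auto simp: P2_sets)
  thus "x \<in> C" using x assms(1) by (force simp: msupport_def)
qed

text \<open>
  The complement of the support is a union of open null sets, and by the Lindelof property countably
  many of them suffice.
\<close>

lemma AE_in_msupport: "AE x in \<mu>. x \<in> msupport \<mu>"
proof -
  define F where "F = {U :: 'a set. open U \<and> emeasure \<mu> U = 0}"
  obtain G where G: "G \<subseteq> F" "countable G" "\<Union>G = \<Union>F"
    using Lindelof[of F] by (auto simp: F_def)
  have "\<Union>G \<in> null_sets \<mu>"
    using G by (intro null_sets_UN'[of G "\<lambda>U. U", simplified])
      (auto simp: F_def null_sets_def P2_sets)
  hence "AE x in \<mu>. x \<notin> \<Union>G" by (rule AE_not_in)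
  moreover have "x \<in> msupport \<mu>" if "x \<notin> \<Union>G" for x
    using that unfolding G(3) by (auto simp: msupport_def F_def zero_less_iff_neq_zero)
  ultimately show ?thesis by (auto elim: eventually_mono)
qed

lemma AE_in_support_span: "AE x in \<mu>. x \<in> support_span \<mu>"
  using AE_in_msupport by (rule eventually_mono) (auto simp: support_span_def span_base)

lemma integral_support_span:
  fixes g :: "'a \<Rightarrow> real"
  assumes [measurable]: "g \<in> borel_measurable borel"
  shows "(LINT y:support_span \<mu>|\<mu>. g y) = (LINT y|\<mu>. g y)"
proof -
  have [measurable]: "support_span \<mu> \<in> sets borel"
    unfolding support_span_def by (intro borel_closed closed_subspace subspace_span)
  show ?thesis
    unfolding set_lebesgue_integral_def
    by (intro integral_cong_AE) (use AE_in_support_span in \<open>auto elim: eventually_mono\<close>)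
qed

text \<open>
  If \<open>b\<close> has eigenvalue \<open>0\<close>, then \<open>(b \<bullet> y)\<^sup>2\<close> has integral \<open>0\<close>, so almost every \<open>y\<close> is orthogonal
  to \<open>b\<close>. The span of the other basis vectors is therefore a closed set of full measure and contains
  the support. Conversely, \<open>S b\<close> is an average of vectors of the span of the support, so
  a basis vector with nonzero eigenvalue lies in that span as well.
\<close>

lemma support_span_eq_span_nonzero_eigenvectors:
  assumes B: "orthonormal_eigenbasis (frame_operator \<mu>) UNIV B"
  shows "support_span \<mu> = span {b \<in> B. frame_operator \<mu> b \<bullet> b \<noteq> 0}"
proof
  let ?S = "frame_operator \<mu>" and ?E = "support_span \<mu>"
  let ?P = "{b \<in> B. ?S b \<bullet> b \<noteq> 0}"
  note basis = frame_operator_selfadjoint B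
  have "msupport \<mu> \<subseteq> span ?P"
  proof (rule msupport_subset_closed)
    have "AE y in \<mu>. b \<bullet> y = 0" if "b \<in> B - ?P" for b
    proof -
      have "(LINT y|\<mu>. (b \<bullet> y)\<^sup>2) = 0"
        using that by (simp add: frame_operator_quadratic_form)
      thus ?thesis
        using P2_integrable_inner_inner[of b b]
        by (subst (asm) integral_nonneg_eq_0_iff_AE) (auto simp: power2_eq_square)
    qed
    moreover have "finite (B - ?P)" using eigenbasis_finite[OF basis] by simp
    ultimately have "AE y in \<mu>. \<forall>b\<in>B - ?P. b \<bullet> y = 0"
      by (intro AE_finite_allI) auto
    thus "AE y in \<mu>. y \<in> span ?P"
      by (simp add: mem_span_subset_eigenbasis[OF basis] inner_commute)
  qed (intro closed_subspace subspace_span)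
  thus "?E \<subseteq> span ?P" unfolding support_span_def by (rule span_minimal) (rule subspace_span)
  have "b \<in> ?E" if b: "b \<in> ?P" for b
  proof -
    \<comment> \<open>Membership in the closed subspace is tested against its orthogonal complement: the component
      \<open>z\<close> of \<open>b\<close> is orthogonal to almost every \<open>y\<close>, hence to \<open>S b\<close>, a nonzero multiple of \<open>b\<close>.\<close>
    obtain e z where e: "e \<in> ?E" and z: "\<And>w. w \<in> ?E \<Longrightarrow> orthogonal z w" and bez: "b = e + z"
      using orthogonal_subspace_decomp_exists[of "msupport \<mu>" b] unfolding support_span_def by auto
    have "(?S b \<bullet> b) * (b \<bullet> z) = ?S b \<bullet> z"
      using b eigenbasis_eigen[OF basis, of b] by (metis inner_scaleR_left mem_Collect_eq)
    also have "\<dots> = (LINT y|\<mu>. 0)"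
      unfolding frame_operator_inner
      by (intro integral_cong_AE)
         (use AE_in_support_span z in \<open>auto elim!: eventually_mono simp: orthogonal_def\<close>)
    finally have "b \<bullet> z = 0" using b by simp
    moreover have "b \<bullet> z = z \<bullet> z" using z[OF e] by (simp add: bez inner_add orthogonal_def inner_commute)
    ultimately show ?thesis using e bez by simp
  qed
  thus "span ?P \<subseteq> ?E" unfolding support_span_def by (intro span_minimal) auto
qed

section \<open>Trace and Hilbert-Schmidt norm\<close>

lemma frame_operator_trace:
  assumes B: "orthonormal_eigenbasis (frame_operator \<mu>) UNIV B"
  shows "(\<Sum>b\<in>B. frame_operator \<mu> b \<bullet> b) = (M2 \<mu>)\<^sup>2"
proof -
  note basis = frame_operator_selfadjoint B
  have "(\<Sum>b\<in>B. frame_operator \<mu> b \<bullet> b) = (LINT y|\<mu>. (\<Sum>b\<in>B. (b \<bullet> y) * (b \<bullet> y)))"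
    by (simp add: frame_operator_inner P2_integrable_inner_inner)
  also have "\<dots> = (LINT y|\<mu>. (norm y)\<^sup>2)"
    by (intro Bochner_Integration.integral_cong refl,
        subst power2_norm_eq_inner, subst eigenbasis_parseval[OF basis])
       (simp add: inner_commute)
  also have "\<dots> = (M2 \<mu>)\<^sup>2" by (simp add: M2_def)
  finally show ?thesis .
qed

lemma PFP_eq_sum_squares:
  assumes B: "orthonormal_eigenbasis (frame_operator \<mu>) UNIV B"
  shows "PFP \<mu> = (\<Sum>b\<in>B. (frame_operator \<mu> b \<bullet> b)\<^sup>2)"
proof -
  note basis = frame_operator_selfadjoint B
  let ?S = "frame_operator \<mu>"
  have "PFP \<mu> = (LINT y|\<mu>. ?S y \<bullet> y)"
    by (simp only: PFP_def frame_operator_quadratic_form power2_abs) (simp only: inner_commute)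
  also have "\<dots> = (LINT y|\<mu>. (\<Sum>b\<in>B. (?S b \<bullet> b) * ((b \<bullet> y) * (b \<bullet> y))))"
    by (intro Bochner_Integration.integral_cong refl, subst eigenbasis_quadratic_form[OF basis])
       (simp add: power2_eq_square inner_commute)
  also have "\<dots> = (\<Sum>b\<in>B. (?S b \<bullet> b)\<^sup>2)"
    by (simp add: P2_integrable_inner_inner power2_eq_square flip: frame_operator_inner)
  finally show ?thesis .
qed

text \<open>
  On the span of the support both sides diagonalise: the quadratic form of \<open>S\<close> has coefficients
  \<open>S b \<bullet> b\<close>, and the squared norm has coefficients \<open>1\<close>.
\<close>

lemma prob_tight_frame_iff_eigenvalues_equal:
  assumes B: "orthonormal_eigenbasis (frame_operator \<mu>) UNIV B"
  shows "prob_tight_frame_for \<mu> (support_span \<mu>) \<longleftrightarrow>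
    (\<exists>A>0. \<forall>b\<in>{b \<in> B. frame_operator \<mu> b \<bullet> b \<noteq> 0}. frame_operator \<mu> b \<bullet> b = A)"
proof -
  note basis = frame_operator_selfadjoint B
  let ?S = "frame_operator \<mu>"
  let ?P = "{b \<in> B. ?S b \<bullet> b \<noteq> 0}"
  have E: "support_span \<mu> = span ?P"
    by (rule support_span_eq_span_nonzero_eigenvectors[OF B])
  have int: "(LINT y:span ?P|\<mu>. \<bar>x \<bullet> y\<bar>\<^sup>2) = ?S x \<bullet> x" for x
    using integral_support_span[of "\<lambda>y. \<bar>x \<bullet> y\<bar>\<^sup>2"]
    by (simp add: frame_operator_quadratic_form E)
  have "(\<forall>x\<in>span ?P. ?S x \<bullet> x = A * (norm x)\<^sup>2) \<longleftrightarrow> (\<forall>b\<in>?P. ?S b \<bullet> b = A)" for A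
  proof
    assume *: "\<forall>x\<in>span ?P. ?S x \<bullet> x = A * (norm x)\<^sup>2"
    show "\<forall>b\<in>?P. ?S b \<bullet> b = A"
    proof
      fix b assume b: "b \<in> ?P"
      hence "norm b = 1" using eigenbasis_norm[OF basis] by simp
      with bspec[OF * span_base[OF b]] show "?S b \<bullet> b = A" by simp
    qed
  next
    assume *: "\<forall>b\<in>?P. ?S b \<bullet> b = A"
    show "\<forall>x\<in>span ?P. ?S x \<bullet> x = A * (norm x)\<^sup>2"
    proof
      fix x assume "x \<in> span ?P"
      hence "\<forall>b\<in>B - ?P. x \<bullet> b = 0"
        using mem_span_subset_eigenbasis[OF basis, of ?P x] by auto
      hence "?S b \<bullet> b = A \<or> x \<bullet> b = 0" if "b \<in> B" for b
        using * that by (cases "b \<in> ?P") blast+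
      hence "(\<Sum>b\<in>B. (?S b \<bullet> b) * (x \<bullet> b)\<^sup>2) = (\<Sum>b\<in>B. A * (x \<bullet> b)\<^sup>2)"
        by (intro sum.cong) auto
      also have "\<dots> = A * (\<Sum>b\<in>B. (x \<bullet> b) * (x \<bullet> b))"
        by (simp only: sum_distrib_left power2_eq_square)
      also have "\<dots> = A * (norm x)\<^sup>2"
        by (simp only: power2_norm_eq_inner eigenbasis_parseval[OF basis, of x x])
      finally show "?S x \<bullet> x = A * (norm x)\<^sup>2"
        by (simp only: eigenbasis_quadratic_form[OF basis, of x])
    qed
  qed
  thus ?thesis unfolding prob_tight_frame_for_def E int by simp
qed

end

section \<open>The lower bound and its equality case\<close>

text \<open>
  This is the Cauchy-Schwarz inequality with its defect written out, so that the equality case is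
  visible: the defect vanishes only if all \<open>q b\<close> equal their mean.
\<close>

lemma sum_squares_eq_variance_plus:
  fixes q :: "'b \<Rightarrow> real"
  assumes "finite P" and sum: "(\<Sum>b\<in>P. q b) = 1"
  shows "(\<Sum>b\<in>P. (q b)\<^sup>2) = 1 / real (card P) + (\<Sum>b\<in>P. (q b - 1 / real (card P))\<^sup>2)"
proof -
  have n: "card P \<noteq> 0" using assms by (cases "P = {}") auto
  define m where "m = 1 / real (card P)"
  have "(\<Sum>b\<in>P. (q b - m)\<^sup>2) = (\<Sum>b\<in>P. (q b)\<^sup>2) - 2 * m * (\<Sum>b\<in>P. q b) + real (card P) * m\<^sup>2"
    by (simp add: power2_diff sum.distrib sum_subtractf mult_ac
        flip: sum_distrib_left sum_distrib_right)
  thus ?thesis using n sum by (simp add: m_def power2_eq_square)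
qed

theorem theorem3:
  fixes \<mu> :: "(real ^ 'n) measure" and n :: nat
  assumes "\<mu> \<in> P2"
    and "M2 \<mu> = 1"
    and "n = num_nonzero_eigenvalues (frame_operator \<mu>)"
  shows "PFP \<mu> \<ge> 1 / real n \<and>
    (PFP \<mu> = 1 / real n \<longleftrightarrow> prob_tight_frame_for \<mu> (support_span \<mu>))"
proof -
  let ?S = "frame_operator \<mu>"
  obtain B where B: "orthonormal_eigenbasis ?S UNIV B"
    using frame_operator_has_orthonormal_eigenbasis[OF assms(1)] by blast
  note basis = frame_operator_selfadjoint[OF assms(1)] B
  define P where "P = {b \<in> B. ?S b \<bullet> b \<noteq> 0}"
  have finB: "finite B" by (rule eigenbasis_finite[OF basis])
  hence fin: "finite P" by (simp add: P_def)
  have n: "n = card P"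
    unfolding assms(3) P_def by (rule num_nonzero_eigenvalues_eq_card[OF basis])
  have "(\<Sum>b\<in>P. ?S b \<bullet> b) = (\<Sum>b\<in>B. ?S b \<bullet> b)"
    unfolding P_def using finB by (intro sum.mono_neutral_left) auto
  hence tr: "(\<Sum>b\<in>P. ?S b \<bullet> b) = 1"
    by (simp add: frame_operator_trace[OF assms(1) B] assms(2))
  hence n0: "n > 0" using fin by (cases "P = {}") (auto simp: n card_gt_0_iff)
  have "PFP \<mu> = (\<Sum>b\<in>P. (?S b \<bullet> b)\<^sup>2)"
    unfolding PFP_eq_sum_squares[OF assms(1) B] P_def
    using finB by (intro sum.mono_neutral_right) auto
  hence PFP: "PFP \<mu> = 1 / real n + (\<Sum>b\<in>P. (?S b \<bullet> b - 1 / real n)\<^sup>2)"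
    using sum_squares_eq_variance_plus[OF fin tr] by (simp add: n)
  have "PFP \<mu> = 1 / real n \<longleftrightarrow> (\<forall>b\<in>P. ?S b \<bullet> b = 1 / real n)"
    unfolding PFP using fin by (simp add: sum_nonneg_eq_0_iff)
  also have "\<dots> \<longleftrightarrow> (\<exists>A>0. \<forall>b\<in>P. ?S b \<bullet> b = A)"
  proof
    assume "\<exists>A>0. \<forall>b\<in>P. ?S b \<bullet> b = A"
    then obtain A where A: "\<forall>b\<in>P. ?S b \<bullet> b = A" by blast
    hence "real n * A = 1" using tr by (simp add: n)
    with A show "\<forall>b\<in>P. ?S b \<bullet> b = 1 / real n" using n0 by (simp add: field_simps)
  qed (use n0 in \<open>auto intro!: exI[of _ "1 / real n"]\<close>)
  also have "\<dots> \<longleftrightarrow> prob_tight_frame_for \<mu> (support_span \<mu>)"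
    unfolding P_def by (rule prob_tight_frame_iff_eigenvalues_equal[OF assms(1) B, symmetric])
  finally show ?thesis using PFP by (simp add: sum_nonneg)
qed

end
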